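(* Suppose that $\Psi(\Theta)$ is countable with $\nu_\Psi$ equal to counting measure, that $\pi_\Psi(\psi)>0$ for every $\psi\in\Psi(\Theta)$, and that $\psi_{RB}(x)$ is the unique maximizer of $RB_\Psi(\psi\,|\,x)$ over $\psi\in\Psi(\Theta)$ for all $x$. For $\eta>0$ let $\delta_\eta$ be a Bayes rule for the loss function $$L_{RB,\eta}(\theta,\psi)=\frac{I_{\{\psi\}^c}(\Psi(\theta))}{\max(\eta,\pi_\Psi(\Psi(\theta)))}.$$ Then $\delta_\eta(x)\to\psi_{RB}(x)$ as $\eta\to0$, for every $x\in\mathcal X$.
   Context: Setting. $\{f(\cdot\,|\,\theta):\theta\in\Theta\}$ is a family of probability densities on a sample space $\mathcal X$ with respect to a support measure $\mu$; $\pi$ is a proper prior density on $\Theta$ with respect to a support measure $\nu$, with associated probability measure $\Pi$. The prior predictive density is $m(x)=\int_\Theta \pi(\theta)f(x\,|\,\theta)\,\nu(d\theta)$, and the posterior density is $\pi(\theta\,|\,x)=\pi(\theta)f(x\,|\,\theta)/m(x)$; $x$ is restricted to points with $0<m(x)<\infty$. $\Psi:\Theta\to\Psi(\Theta)$ is a (measurable) parameter of interest, with marginal prior $\Pi_\Psi$ and marginal posterior $\Pi_\Psi(\cdot\,|\,x)$ on $\Psi(\Theta)$, having densities $\pi_\Psi$ and $\pi_\Psi(\cdot\,|\,x)$ with respect to $\nu_\Psi$. The relative belief ratio is $RB_\Psi(\psi\,|\,x)=\pi_\Psi(\psi\,|\,x)/\pi_\Psi(\psi)$, and $\psi_{RB}(x)=\arg\sup_\psi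 RB_\Psi(\psi\,|\,x)$. $I_A$ is the indicator function of a set $A$. Bayes rules. A loss $L(\theta,\psi)$ depends on $\theta$ only through $\Psi(\theta)$, so it may be regarded as a function on $\Psi(\Theta)\times\Psi(\Theta)$. The posterior risk of $\delta:\mathcal X\to\Psi(\Theta)$ is $r(\delta\,|\,x)=\int_{\Psi(\Theta)}L(\psi,\delta(x))\,\Pi_\Psi(d\psi\,|\,x)$. Here a Bayes rule is taken to be a $\delta$ whose value $\delta(x)$ minimizes the posterior risk $r(\cdot\,|\,x)$ over $\Psi(\Theta)$ for each $x$ (such a $\delta$ minimizes the prior risk $\int r(\delta\,|\,x)\,M(dx)$, $M$ being the prior predictive distribution). The countable set $\Psi(\Theta)$ is regarded as a discrete space. *)

theory Defs
  imports "HOL-Probability.Probability"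
begin

definition prior_measure :: "'t measure \<Rightarrow> ('t \<Rightarrow> real) \<Rightarrow> 't measure"
  where "prior_measure \<nu> prior = density \<nu> (\<lambda>\<theta>. ennreal (prior \<theta>))"

definition prior_predictive :: "'t measure \<Rightarrow> ('t \<Rightarrow> real) \<Rightarrow> ('x \<Rightarrow> 't \<Rightarrow> real) \<Rightarrow> 'x \<Rightarrow> ennreal"
  where "prior_predictive \<nu> prior f x = (\<integral>\<^sup>+\<theta>. ennreal (prior \<theta> * f x \<theta>) \<partial>\<nu>)"

text \<open>The posterior is only meaningful at observations whose prior predictive density is positive
  and finite; \<open>admissible\<close> collects these, and every statement about all observations ranges over
  this set.\<close>

definition admissible ::
  "'x measure \<Rightarrow> 't measure \<Rightarrow> ('t \<Rightarrow> real) \<Rightarrow> ('x \<Rightarrow> 't \<Rightarrow> real) \<Rightarrow> 'x set"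
  where "admissible \<mu> \<nu> prior f =
    {x \<in> space \<mu>. 0 < prior_predictive \<nu> prior f x \<and> prior_predictive \<nu> prior f x < \<infinity>}"

definition posterior_measure ::
  "'t measure \<Rightarrow> ('t \<Rightarrow> real) \<Rightarrow> ('x \<Rightarrow> 't \<Rightarrow> real) \<Rightarrow> 'x \<Rightarrow> 't measure"
  where "posterior_measure \<nu> prior f x =
    density \<nu> (\<lambda>\<theta>. ennreal (prior \<theta> * f x \<theta>) / prior_predictive \<nu> prior f x)"

text \<open>In the following locale \<open>f x \<theta>\<close> is the density of the sampling model at \<open>x\<close> given \<open>\<theta>\<close>; the
  sample space is \<open>space \<mu>\<close> and the parameter space is \<open>space \<nu>\<close>. The densities \<open>prior\<^sub>\<Psi>\<close> and
  \<open>post\<^sub>\<Psi> x\<close> of the parameter of interest are arbitrary nonnegative versions of the densities, with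
  respect to \<open>\<nu>\<^sub>\<Psi>\<close>, of the images under \<open>\<Psi>\<close> of the prior and of the posterior.\<close>

locale bayes_model =
  fixes \<mu> :: "'x measure"
    and f :: "'x \<Rightarrow> 't \<Rightarrow> real"
    and \<nu> :: "'t measure"
    and prior :: "'t \<Rightarrow> real"
    and \<Psi> :: "'t \<Rightarrow> 'p"
    and \<nu>\<^sub>\<Psi> :: "'p measure"
    and prior\<^sub>\<Psi> :: "'p \<Rightarrow> real"
    and post\<^sub>\<Psi> :: "'x \<Rightarrow> 'p \<Rightarrow> real"
  assumes f_measurable_obs: "\<And>\<theta>. \<theta> \<in> space \<nu> \<Longrightarrow> (\<lambda>x. f x \<theta>) \<in> borel_measurable \<mu>"
    and f_measurable_par: "\<And>x. x \<in> space \<mu> \<Longrightarrow> f x \<in> borel_measurable \<nu>"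
    and f_nonneg: "\<And>x \<theta>. x \<in> space \<mu> \<Longrightarrow> \<theta> \<in> space \<nu> \<Longrightarrow> 0 \<le> f x \<theta>"
    and f_density: "\<And>\<theta>. \<theta> \<in> space \<nu> \<Longrightarrow> (\<integral>\<^sup>+x. ennreal (f x \<theta>) \<partial>\<mu>) = 1"
    and prior_measurable: "prior \<in> borel_measurable \<nu>"
    and prior_nonneg: "\<And>\<theta>. \<theta> \<in> space \<nu> \<Longrightarrow> 0 \<le> prior \<theta>"
    and prior_proper: "prob_space (prior_measure \<nu> prior)"
    and space_par: "space \<nu>\<^sub>\<Psi> = \<Psi> ` space \<nu>"
    and marginal_prior: "distributed (prior_measure \<nu> prior) \<nu>\<^sub>\<Psi> \<Psi> (\<lambda>\<psi>. ennreal (prior\<^sub>\<Psi> \<psi>))"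
    and marginal_prior_nonneg: "\<And>\<psi>. \<psi> \<in> space \<nu>\<^sub>\<Psi> \<Longrightarrow> 0 \<le> prior\<^sub>\<Psi> \<psi>"
    and marginal_posterior: "\<And>x. x \<in> admissible \<mu> \<nu> prior f \<Longrightarrow>
      distributed (posterior_measure \<nu> prior f x) \<nu>\<^sub>\<Psi> \<Psi> (\<lambda>\<psi>. ennreal (post\<^sub>\<Psi> x \<psi>))"
    and marginal_posterior_nonneg: "\<And>x \<psi>. x \<in> admissible \<mu> \<nu> prior f \<Longrightarrow> \<psi> \<in> space \<nu>\<^sub>\<Psi> \<Longrightarrow>
      0 \<le> post\<^sub>\<Psi> x \<psi>"

definition RB :: "('p \<Rightarrow> real) \<Rightarrow> ('x \<Rightarrow> 'p \<Rightarrow> real) \<Rightarrow> 'x \<Rightarrow> 'p \<Rightarrow> real"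
  where "RB prior\<^sub>\<Psi> post\<^sub>\<Psi> x \<psi> = post\<^sub>\<Psi> x \<psi> / prior\<^sub>\<Psi> \<psi>"

definition psi_RB :: "'p set \<Rightarrow> ('p \<Rightarrow> real) \<Rightarrow> ('x \<Rightarrow> 'p \<Rightarrow> real) \<Rightarrow> 'x \<Rightarrow> 'p"
  where "psi_RB S prior\<^sub>\<Psi> post\<^sub>\<Psi> x = arg_max_on (RB prior\<^sub>\<Psi> post\<^sub>\<Psi> x) S"

text \<open>Losses depend on \<open>\<theta>\<close> only through \<open>\<Psi> \<theta>\<close>, so a loss takes the true value of the parameter of
  interest, \<open>\<psi> = \<Psi> \<theta>\<close>, and the action \<open>a\<close>. Losses are nonnegative, and the risk is a nonnegative
  integral in \<open>ennreal\<close>, so that an infinite risk is not mistaken for zero.\<close>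

definition posterior_risk ::
  "'t measure \<Rightarrow> ('t \<Rightarrow> real) \<Rightarrow> ('x \<Rightarrow> 't \<Rightarrow> real) \<Rightarrow> ('t \<Rightarrow> 'p) \<Rightarrow> 'p measure \<Rightarrow>
    ('p \<Rightarrow> 'p \<Rightarrow> real) \<Rightarrow> 'x \<Rightarrow> 'p \<Rightarrow> ennreal"
  where "posterior_risk \<nu> prior f \<Psi> \<nu>\<^sub>\<Psi> L x a =
    (\<integral>\<^sup>+\<psi>. ennreal (L \<psi> a) \<partial>(distr (posterior_measure \<nu> prior f x) \<nu>\<^sub>\<Psi> \<Psi>))"

definition bayes_rule ::
  "'x measure \<Rightarrow> 't measure \<Rightarrow> ('t \<Rightarrow> real) \<Rightarrow> ('x \<Rightarrow> 't \<Rightarrow> real) \<Rightarrow> ('t \<Rightarrow> 'p) \<Rightarrow> 'p measure \<Rightarrow>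
    ('p \<Rightarrow> 'p \<Rightarrow> real) \<Rightarrow> ('x \<Rightarrow> 'p) \<Rightarrow> bool"
  where "bayes_rule \<mu> \<nu> prior f \<Psi> \<nu>\<^sub>\<Psi> L \<delta> \<longleftrightarrow>
    (\<forall>x \<in> admissible \<mu> \<nu> prior f.
      is_arg_min (posterior_risk \<nu> prior f \<Psi> \<nu>\<^sub>\<Psi> L x) (\<lambda>a. a \<in> \<Psi> ` space \<nu>) (\<delta> x))"

definition loss_RB :: "('p \<Rightarrow> real) \<Rightarrow> real \<Rightarrow> 'p \<Rightarrow> 'p \<Rightarrow> real"
  where "loss_RB prior\<^sub>\<Psi> \<eta> \<psi> a = indicator (- {a}) \<psi> / max \<eta> (prior\<^sub>\<Psi> \<psi>)"

end

theory Submission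
  imports Defs
begin

text \<open>Write \<open>p\<close> for the posterior and \<open>q\<close> for the prior density of the parameter of interest. The
  loss is \<open>1 / max \<eta> (q \<psi>)\<close> for every action \<open>a \<noteq> \<psi>\<close> and vanishes for
  \<open>a = \<psi>\<close>, so the posterior risk of \<open>a\<close> is
  \<open>C - p a / max \<eta> (q a)\<close>, where \<open>C = (\<Sum>\<psi>. p \<psi> / max \<eta> (q \<psi>))\<close> does not depend on \<open>a\<close>
  (lemma \<open>risk_plus_gain\<close>) and is at most \<open>1 / \<eta>\<close>, hence finite (lemma \<open>total_gain_finite\<close>).
  Minimising the risk therefore amounts to maximising the truncated relative belief ratio
  \<open>p a / max \<eta> (q a)\<close>.

  Truncation can only lower the ratio \<open>p a / q a\<close>, and it does not change it at the maximiser
  \<open>\<psi>\<^sub>R\<^sub>B\<close> once \<open>\<eta> \<le> q \<psi>\<^sub>R\<^sub>B\<close>. So for all these \<open>\<eta>\<close> the truncated ratio still has \<open>\<psi>\<^sub>R\<^sub>B\<close> as its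
  unique maximiser. The Bayes rule thus equals \<open>\<psi>\<^sub>R\<^sub>B\<close> for every \<open>\<eta>\<close> in
  \<open>(0, q \<psi>\<^sub>R\<^sub>B]\<close>, which is convergence in the discrete topology.\<close>

text \<open>Normalisation by the prior predictive value is what makes the total mass one; an observation
  with predictive value zero or infinity would break the cancellation.\<close>

lemma (in bayes_model) emeasure_posterior_space:
  assumes "x \<in> admissible \<mu> \<nu> prior f"
  shows "emeasure (posterior_measure \<nu> prior f x) (space \<nu>) = 1"
proof -
  have m: "prior_predictive \<nu> prior f x \<noteq> 0" "prior_predictive \<nu> prior f x \<noteq> \<infinity>"
    and x: "x \<in> space \<mu>"
    using assms by (auto simp: admissible_def)
  have [measurable]: "prior \<in> borel_measurable \<nu>" "f x \<in> borel_measurable \<nu>"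
    using prior_measurable f_measurable_par[OF x] .
  have "emeasure (posterior_measure \<nu> prior f x) (space \<nu>) =
      (\<integral>\<^sup>+\<theta>. ennreal (prior \<theta> * f x \<theta>) / prior_predictive \<nu> prior f x \<partial>\<nu>)"
    unfolding posterior_measure_def
    by (subst emeasure_density) (auto intro!: nn_integral_cong)
  also have "\<dots> = prior_predictive \<nu> prior f x / prior_predictive \<nu> prior f x"
    by (subst nn_integral_divide) (auto simp: prior_predictive_def)
  also have "\<dots> = 1"
    using m by (simp add: ennreal_divide_self top.not_eq_extremum)
  finally show ?thesis .
qed

lemma (in bayes_model) nn_integral_marginal_posterior:
  assumes x: "x \<in> admissible \<mu> \<nu> prior f"
  shows "(\<integral>\<^sup>+\<psi>. ennreal (post\<^sub>\<Psi> x \<psi>) \<partial>\<nu>\<^sub>\<Psi>) = 1"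
proof -
  let ?P = "posterior_measure \<nu> prior f x"
  note d = marginal_posterior[OF x]
  have [measurable]: "\<Psi> \<in> measurable ?P \<nu>\<^sub>\<Psi>" "(\<lambda>\<psi>. ennreal (post\<^sub>\<Psi> x \<psi>)) \<in> borel_measurable \<nu>\<^sub>\<Psi>"
    using d by (auto simp: distributed_def)
  have space_P: "space ?P = space \<nu>"
    by (simp add: posterior_measure_def)
  have "(\<integral>\<^sup>+\<psi>. ennreal (post\<^sub>\<Psi> x \<psi>) \<partial>\<nu>\<^sub>\<Psi>) = emeasure (density \<nu>\<^sub>\<Psi> (\<lambda>\<psi>. ennreal (post\<^sub>\<Psi> x \<psi>))) (space \<nu>\<^sub>\<Psi>)"
    by (subst emeasure_density) (auto intro!: nn_integral_cong)
  also have "\<dots> = emeasure (distr ?P \<nu>\<^sub>\<Psi> \<Psi>) (space \<nu>\<^sub>\<Psi>)"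
    using d by (simp add: distributed_def)
  also have "\<dots> = emeasure ?P (space \<nu>)"
    using measurable_space[of \<Psi> ?P \<nu>\<^sub>\<Psi>] space_P
    by (subst emeasure_distr) (auto intro!: arg_cong2[where f = emeasure])
  also have "\<dots> = 1"
    by (rule emeasure_posterior_space[OF x])
  finally show ?thesis .
qed

lemma (in bayes_model) posterior_risk_eq_nn_integral:
  assumes x: "x \<in> admissible \<mu> \<nu> prior f"
    and L: "(\<lambda>\<psi>. L \<psi> a) \<in> borel_measurable \<nu>\<^sub>\<Psi>"
  shows "posterior_risk \<nu> prior f \<Psi> \<nu>\<^sub>\<Psi> L x a =
    (\<integral>\<^sup>+\<psi>. ennreal (post\<^sub>\<Psi> x \<psi>) * ennreal (L \<psi> a) \<partial>\<nu>\<^sub>\<Psi>)"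
proof -
  have "distr (posterior_measure \<nu> prior f x) \<nu>\<^sub>\<Psi> \<Psi> = density \<nu>\<^sub>\<Psi> (\<lambda>\<psi>. ennreal (post\<^sub>\<Psi> x \<psi>))"
    and "(\<lambda>\<psi>. ennreal (post\<^sub>\<Psi> x \<psi>)) \<in> borel_measurable \<nu>\<^sub>\<Psi>"
    using marginal_posterior[OF x] by (auto simp: distributed_def)
  then show ?thesis
    using L by (simp add: posterior_risk_def nn_integral_density)
qed

text \<open>The term of the sum at \<open>\<psi> = a\<close> is exactly the one that the loss of action \<open>a\<close> leaves out.
  The identity is stated additively because subtraction of extended reals would need the
  finiteness of the right-hand side.\<close>

lemma risk_plus_gain:
  assumes "a \<in> S" "0 \<le> p a" "0 < \<eta>"
  shows "(\<integral>\<^sup>+\<psi>. ennreal (p \<psi>) * ennreal (loss_RB q \<eta> \<psi> a) \<partial>count_space S)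
      + ennreal (p a / max \<eta> (q a))
    = (\<integral>\<^sup>+\<psi>. ennreal (p \<psi>) * ennreal (1 / max \<eta> (q \<psi>)) \<partial>count_space S)"
proof -
  let ?g = "ennreal (p a / max \<eta> (q a))"
  have "(\<integral>\<^sup>+\<psi>. ennreal (p \<psi>) * ennreal (1 / max \<eta> (q \<psi>)) \<partial>count_space S) =
      (\<integral>\<^sup>+\<psi>. ennreal (p \<psi>) * ennreal (loss_RB q \<eta> \<psi> a) + ?g * indicator {a} \<psi> \<partial>count_space S)"
    using assms
    by (intro nn_integral_cong)
       (auto simp: loss_RB_def indicator_def ennreal_mult[symmetric])
  also have "\<dots> = (\<integral>\<^sup>+\<psi>. ennreal (p \<psi>) * ennreal (loss_RB q \<eta> \<psi> a) \<partial>count_space S)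
      + (\<integral>\<^sup>+\<psi>. ?g * indicator {a} \<psi> \<partial>count_space S)"
    by (rule nn_integral_add) auto
  also have "(\<integral>\<^sup>+\<psi>. ?g * indicator {a} \<psi> \<partial>count_space S) = ?g"
    using assms by (subst nn_integral_cmult_indicator) auto
  finally show ?thesis
    by simp
qed

text \<open>This is where truncation at \<open>\<eta>\<close> is needed: without it the sum is that of the relative belief
  ratios, which may diverge, and then every action would have infinite risk.\<close>

lemma total_gain_finite:
  assumes "0 < \<eta>" "(\<integral>\<^sup>+\<psi>. ennreal (p \<psi>) \<partial>count_space S) < \<infinity>"
  shows "(\<integral>\<^sup>+\<psi>. ennreal (p \<psi>) * ennreal (1 / max \<eta> (q \<psi>)) \<partial>count_space S) < \<infinity>"
proof -
  have "(\<integral>\<^sup>+\<psi>. ennreal (p \<psi>) * ennreal (1 / max \<eta> (q \<psi>)) \<partial>count_space S)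
      \<le> (\<integral>\<^sup>+\<psi>. ennreal (p \<psi>) * ennreal (1 / \<eta>) \<partial>count_space S)"
    using assms(1) by (intro nn_integral_mono mult_left_mono ennreal_leI divide_left_mono) auto
  also have "\<dots> = (\<integral>\<^sup>+\<psi>. ennreal (p \<psi>) \<partial>count_space S) * ennreal (1 / \<eta>)"
    by (rule nn_integral_multc) simp
  also have "\<dots> < \<infinity>"
    using assms(2) by (simp add: ennreal_mult_less_top)
  finally show ?thesis .
qed

text \<open>Risk and truncated ratio of an action add up to the same finite constant for all actions, so
  a comparison of risks reverses into one of truncated ratios; finiteness of the risk of \<open>s\<close> allows
  it to be cancelled.\<close>

lemma (in bayes_model) bayes_action_maximizes_truncated_RB:
  assumes x: "x \<in> admissible \<mu> \<nu> prior f"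
    and counting: "\<nu>\<^sub>\<Psi> = count_space S"
    and \<eta>: "0 < \<eta>"
    and d: "is_arg_min (posterior_risk \<nu> prior f \<Psi> \<nu>\<^sub>\<Psi> (loss_RB prior\<^sub>\<Psi> \<eta>) x) (\<lambda>a. a \<in> S) d"
    and s: "s \<in> S"
  shows "post\<^sub>\<Psi> x s / max \<eta> (prior\<^sub>\<Psi> s) \<le> post\<^sub>\<Psi> x d / max \<eta> (prior\<^sub>\<Psi> d)"
proof -
  let ?r = "posterior_risk \<nu> prior f \<Psi> \<nu>\<^sub>\<Psi> (loss_RB prior\<^sub>\<Psi> \<eta>) x"
  let ?g = "\<lambda>a. post\<^sub>\<Psi> x a / max \<eta> (prior\<^sub>\<Psi> a)"
  let ?C = "\<integral>\<^sup>+\<psi>. ennreal (post\<^sub>\<Psi> x \<psi>) * ennreal (1 / max \<eta> (prior\<^sub>\<Psi> \<psi>)) \<partial>count_space S"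
  have nonneg: "0 \<le> post\<^sub>\<Psi> x \<psi>" if "\<psi> \<in> S" for \<psi>
    using marginal_posterior_nonneg[OF x] that by (simp add: counting)
  have risk: "?r a + ennreal (?g a) = ?C" if "a \<in> S" for a
    using risk_plus_gain[of a S "post\<^sub>\<Psi> x" \<eta> "prior\<^sub>\<Psi>"] that nonneg[OF that] \<eta>
      posterior_risk_eq_nn_integral[OF x, of "loss_RB prior\<^sub>\<Psi> \<eta>" a]
    unfolding counting by simp
  have "?C < \<infinity>"
    using nn_integral_marginal_posterior[OF x] \<eta> by (intro total_gain_finite) (auto simp: counting)
  then have fin: "?r s \<noteq> \<infinity>"
    using risk[OF s] by auto
  have dS: "d \<in> S" and "?r d \<le> ?r s"
    using d s by (auto simp: is_arg_min_def not_less)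
  then have "?r s + ennreal (?g s) \<le> ?r s + ennreal (?g d)"
    using risk[OF s] risk[OF dS] by (metis add_right_mono)
  then have "ennreal (?g s) \<le> ennreal (?g d)"
    using fin by (simp add: ennreal_add_left_cancel_le)
  moreover have "0 \<le> ?g d"
    using nonneg[OF dS] \<eta> by simp
  ultimately show ?thesis
    by (simp add: ennreal_le_iff)
qed

theorem theorem2:
  fixes \<mu> :: "'x measure" and f :: "'x \<Rightarrow> 't \<Rightarrow> real"
    and \<nu> :: "'t measure" and prior :: "'t \<Rightarrow> real"
    and \<Psi> :: "'t \<Rightarrow> 'p" and \<nu>\<^sub>\<Psi> :: "'p measure"
    and prior\<^sub>\<Psi> :: "'p \<Rightarrow> real" and post\<^sub>\<Psi> :: "'x \<Rightarrow> 'p \<Rightarrow> real"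
    and \<delta> :: "real \<Rightarrow> 'x \<Rightarrow> 'p"
  assumes model: "bayes_model \<mu> f \<nu> prior \<Psi> \<nu>\<^sub>\<Psi> prior\<^sub>\<Psi> post\<^sub>\<Psi>"
    and countable_par: "countable (\<Psi> ` space \<nu>)"
    and counting: "\<nu>\<^sub>\<Psi> = count_space (\<Psi> ` space \<nu>)"
    and prior_pos: "\<And>\<psi>. \<psi> \<in> \<Psi> ` space \<nu> \<Longrightarrow> 0 < prior\<^sub>\<Psi> \<psi>"
    and unique_max: "\<And>x \<psi>. x \<in> admissible \<mu> \<nu> prior f \<Longrightarrow>
      is_arg_max (RB prior\<^sub>\<Psi> post\<^sub>\<Psi> x) (\<lambda>\<psi>. \<psi> \<in> \<Psi> ` space \<nu>) \<psi>
        \<longleftrightarrow> \<psi> = psi_RB (\<Psi> ` space \<nu>) prior\<^sub>\<Psi> post\<^sub>\<Psi> x"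
    and bayes: "\<And>\<eta>. 0 < \<eta> \<Longrightarrow>
      bayes_rule \<mu> \<nu> prior f \<Psi> \<nu>\<^sub>\<Psi> (loss_RB prior\<^sub>\<Psi> \<eta>) (\<delta> \<eta>)"
  shows "\<forall>x \<in> admissible \<mu> \<nu> prior f.
    limitin (discrete_topology (\<Psi> ` space \<nu>)) (\<lambda>\<eta>. \<delta> \<eta> x)
      (psi_RB (\<Psi> ` space \<nu>) prior\<^sub>\<Psi> post\<^sub>\<Psi> x) (at_right 0)"
proof
  fix x
  assume x: "x \<in> admissible \<mu> \<nu> prior f"
  interpret bayes_model \<mu> f \<nu> prior \<Psi> \<nu>\<^sub>\<Psi> prior\<^sub>\<Psi> post\<^sub>\<Psi>
    by (rule model)
  define S where "S = \<Psi> ` space \<nu>"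
  define s where "s = psi_RB S prior\<^sub>\<Psi> post\<^sub>\<Psi> x"
  let ?RB = "RB prior\<^sub>\<Psi> post\<^sub>\<Psi> x"
  have max_iff: "is_arg_max ?RB (\<lambda>\<psi>. \<psi> \<in> S) \<psi> \<longleftrightarrow> \<psi> = s" for \<psi>
    unfolding S_def s_def by (rule unique_max[OF x])
  then have arg_max: "is_arg_max ?RB (\<lambda>\<psi>. \<psi> \<in> S) s"
    by simp
  then have sS: "s \<in> S"
    by (simp add: is_arg_max_def)
  have "\<delta> \<eta> x = s" if \<eta>: "0 < \<eta>" "\<eta> \<le> prior\<^sub>\<Psi> s" for \<eta>
  proof -
    let ?d = "\<delta> \<eta> x"
    have d: "is_arg_min (posterior_risk \<nu> prior f \<Psi> \<nu>\<^sub>\<Psi> (loss_RB prior\<^sub>\<Psi> \<eta>) x) (\<lambda>a. a \<in> S) ?d"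
      using bayes[OF \<eta>(1)] x by (simp add: bayes_rule_def S_def)
    then have dS: "?d \<in> S"
      by (simp add: is_arg_min_def)
    \<comment> \<open>Truncation is inactive at the maximiser and only lowers the ratio at the Bayes action.\<close>
    have "?RB s = post\<^sub>\<Psi> x s / max \<eta> (prior\<^sub>\<Psi> s)"
      using \<eta> by (simp add: RB_def max_def)
    also have "\<dots> \<le> post\<^sub>\<Psi> x ?d / max \<eta> (prior\<^sub>\<Psi> ?d)"
      using x counting[folded S_def] \<eta>(1) d sS by (rule bayes_action_maximizes_truncated_RB)
    also have "\<dots> \<le> ?RB ?d"
      unfolding RB_def
      using marginal_posterior_nonneg[OF x] prior_pos dS \<eta>(1)
      by (intro divide_left_mono) (auto simp: S_def space_par)
    finally have "?RB s \<le> ?RB ?d" .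
    then have "is_arg_max ?RB (\<lambda>\<psi>. \<psi> \<in> S) ?d"
      using arg_max dS by (auto simp: is_arg_max_def not_less intro: order_trans)
    then show ?thesis
      using max_iff by simp
  qed
  moreover have "0 < prior\<^sub>\<Psi> s"
    using prior_pos sS by (simp add: S_def)
  then have "eventually (\<lambda>\<eta>. 0 < \<eta> \<and> \<eta> \<le> prior\<^sub>\<Psi> s) (at_right 0)"
    unfolding eventually_at_right_field by (auto intro!: exI[of _ "prior\<^sub>\<Psi> s"])
  ultimately have "eventually (\<lambda>\<eta>. \<delta> \<eta> x = s) (at_right 0)"
    by (auto elim: eventually_mono)
  then show "limitin (discrete_topology (\<Psi> ` space \<nu>)) (\<lambda>\<eta>. \<delta> \<eta> x)
      (psi_RB (\<Psi> ` space \<nu>) prior\<^sub>\<Psi> post\<^sub>\<Psi> x) (at_right 0)"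
    using sS by (auto simp: limitin_def S_def s_def elim: eventually_mono)
qed

end
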